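(* Let $G$ be a finite simple graph with vertices $v_1,\ldots,v_n$ and let $L$ be a list of $G$. Then $$\overrightarrow{W}(G,L)=R(\overrightarrow{W}_{max}(G,L)),$$ i.e. $G$ is $(L,w)$-colorable if and only if there exists $\vec w'\in\overrightarrow{W}_{max}(G,L)$ with $\vec w\le\vec w'$.
   Context: A list of $G$ is a map $L$ assigning to each vertex $v$ a finite set $L(v)\subset\mathbb{N}$; $\overline{L}=\bigcup_{v}L(v)$. A weight is a map $w:V(G)\to\mathbb{N}$, with weight-vector $\vec w=\sum_i w(v_i)\vec e_i\in\mathbb N^n$. An $(L,w)$-coloring of $G$ is a map $C$ with $C(v)\subset L(v)$, $|C(v)|=w(v)$ for all $v$, and $C(v)\cap C(v')=\emptyset$ for every edge $vv'$; $G$ is $(L,w)$-colorable if such a coloring exists. $\overrightarrow{W}(G,L)$ is the set of weight-vectors $\vec w\in\mathbb N^n$ such that $G$ is $(L,w)$-colorable. On $\mathbb N^n$, $\vec y\le\vec x$ means $y_i\le x_i$ for all $i$; for a finite set $X\subset\mathbb N^n$, $R(X)=\{\vec y\in\mathbb N^n:\vec y\le\vec x$ for some $\vec x\in X\}$. For $N\subset V(G)$, $\vec N=\sum_i\lambda_i\vec e_i$ with $\lambda_i=1$ if $v_i\in N$ and $0$ otherwise. For a color $x$, $G^x$ is the subgraph of $G$ induced by the vertices $v$ with $x\in L(v)$. For a subgraph $H$, $\overrightarrow{MIS}(H)=\{\vec N\in\mathbb N^n: N$ is a maximal (w.r.t. inclusion) independent set of $H\}$. $\overrightarrow{W}_{max}(G,L)=\sum_{x\in\overline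 L}\overrightarrow{MIS}(G^x)$, the vectorial sum (all sums $\sum_x\vec z_x$ with $\vec z_x\in\overrightarrow{MIS}(G^x)$). *)

theory Defs
  imports
    "Graph_Theory.Digraph_Component"
    "HOL-Library.Function_Algebras"
    "HOL-Library.Set_Algebras"
begin

text \<open>
  A finite simple graph is a graph in the sense of the locale \<^locale>\<open>graph\<close>:
  every undirected edge \<open>uv\<close> is the pair of arcs \<open>(u, v)\<close>, \<open>(v, u)\<close>. Its vertices are
  enumerated as \<open>v 1, \<dots>, v n\<close> by a bijection \<open>v\<close> from \<open>{1..n}\<close>.

  Vectors of \<open>\<nat>\<^sup>n\<close> are functions \<open>nat \<Rightarrow> nat\<close> vanishing outside \<open>{1..n}\<close>, so that
  addition, finite sums and \<open>\<le>\<close> are the pointwise library operations on functions, and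
  the vectorial sum of sets is the library sum on sets.
\<close>

definition nat_vecs :: "nat \<Rightarrow> (nat \<Rightarrow> nat) set" where
  "nat_vecs n = {x. \<forall>i. i \<notin> {1..n} \<longrightarrow> x i = 0}"

definition unit_vec :: "nat \<Rightarrow> nat \<Rightarrow> nat" where
  "unit_vec i = (\<lambda>j. if j = i then 1 else 0)"

definition vec_of :: "nat \<Rightarrow> (nat \<Rightarrow> nat) \<Rightarrow> (nat \<Rightarrow> nat)" where
  "vec_of n c = (\<Sum>i\<in>{1..n}. (\<lambda>j. c i * unit_vec i j))"

definition weight_vec :: "nat \<Rightarrow> (nat \<Rightarrow> 'a) \<Rightarrow> ('a \<Rightarrow> nat) \<Rightarrow> (nat \<Rightarrow> nat)" where
  "weight_vec n v w = vec_of n (\<lambda>i. w (v i))"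

definition vset_vec :: "nat \<Rightarrow> (nat \<Rightarrow> 'a) \<Rightarrow> 'a set \<Rightarrow> (nat \<Rightarrow> nat)" where
  "vset_vec n v N = vec_of n (\<lambda>i. if v i \<in> N then 1 else 0)"

definition lower_closure :: "nat \<Rightarrow> (nat \<Rightarrow> nat) set \<Rightarrow> (nat \<Rightarrow> nat) set" where
  "lower_closure n X = {y \<in> nat_vecs n. \<exists>x\<in>X. y \<le> x}"

definition is_list :: "('a, 'b) pre_digraph \<Rightarrow> ('a \<Rightarrow> nat set) \<Rightarrow> bool" where
  "is_list G L \<longleftrightarrow> (\<forall>u\<in>verts G. finite (L u))"

definition all_colors :: "('a, 'b) pre_digraph \<Rightarrow> ('a \<Rightarrow> nat set) \<Rightarrow> nat set" where
  "all_colors G L = (\<Union>u\<in>verts G. L u)"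

definition is_coloring ::
  "('a, 'b) pre_digraph \<Rightarrow> ('a \<Rightarrow> nat set) \<Rightarrow> ('a \<Rightarrow> nat) \<Rightarrow> ('a \<Rightarrow> nat set) \<Rightarrow> bool" where
  "is_coloring G L w C \<longleftrightarrow>
     (\<forall>u\<in>verts G. C u \<subseteq> L u \<and> card (C u) = w u) \<and>
     (\<forall>(u, u')\<in>arcs_ends G. C u \<inter> C u' = {})"

definition colorable ::
  "('a, 'b) pre_digraph \<Rightarrow> ('a \<Rightarrow> nat set) \<Rightarrow> ('a \<Rightarrow> nat) \<Rightarrow> bool" where
  "colorable G L w \<longleftrightarrow> (\<exists>C. is_coloring G L w C)"

definition W :: "nat \<Rightarrow> (nat \<Rightarrow> 'a) \<Rightarrow> ('a, 'b) pre_digraph \<Rightarrow> ('a \<Rightarrow> nat set) \<Rightarrow> (nat \<Rightarrow> nat) set" where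
  "W n v G L = {weight_vec n v w | w. colorable G L w}"

definition color_graph ::
  "('a, 'b) pre_digraph \<Rightarrow> ('a \<Rightarrow> nat set) \<Rightarrow> nat \<Rightarrow> ('a, 'b) pre_digraph" where
  "color_graph G L x = G \<restriction> {u \<in> verts G. x \<in> L u}"

definition independent_set :: "('a, 'b) pre_digraph \<Rightarrow> 'a set \<Rightarrow> bool" where
  "independent_set H N \<longleftrightarrow> N \<subseteq> verts H \<and> (\<forall>u\<in>N. \<forall>u'\<in>N. (u, u') \<notin> arcs_ends H)"

definition maximal_independent_set :: "('a, 'b) pre_digraph \<Rightarrow> 'a set \<Rightarrow> bool" where
  "maximal_independent_set H N \<longleftrightarrow>
     independent_set H N \<and> (\<nexists>M. independent_set H M \<and> N \<subset> M)"

definition MIS :: "nat \<Rightarrow> (nat \<Rightarrow> 'a) \<Rightarrow> ('a, 'b) pre_digraph \<Rightarrow> (nat \<Rightarrow> nat) set" where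
  "MIS n v H = {vset_vec n v N | N. maximal_independent_set H N}"

definition W_max ::
  "nat \<Rightarrow> (nat \<Rightarrow> 'a) \<Rightarrow> ('a, 'b) pre_digraph \<Rightarrow> ('a \<Rightarrow> nat set) \<Rightarrow> (nat \<Rightarrow> nat) set" where
  "W_max n v G L = (\<Sum>x\<in>all_colors G L. MIS n v (color_graph G L x))"

lemma vec_of_apply: "vec_of n c j = (if j \<in> {1..n} then c j else 0)"
proof -
  have "(\<Sum>i\<in>A. (\<lambda>j. c i * unit_vec i j)) j = (\<Sum>i\<in>A. c i * unit_vec i j)" for A
    by (induction A rule: infinite_finite_induct) auto
  then show ?thesis
    by (simp add: vec_of_def unit_vec_def if_distrib cong: if_cong)
qed

lemma W_max_alt:
  assumes "graph G" "is_list G L"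
  shows "W_max n v G L =
    {\<Sum>x\<in>all_colors G L. z x | z. \<forall>x\<in>all_colors G L. z x \<in> MIS n v (color_graph G L x)}"
proof -
  interpret graph G by fact
  have "finite (all_colors G L)"
    using assms(2) by (simp add: all_colors_def is_list_def)
  then show ?thesis
    unfolding W_max_def by (rule set_sum_alt)
qed

end

theory Submission
  imports Defs
begin

text \<open>
  A coloring is the same as a family of color classes \<open>N x\<close>, each independent in \<open>G\<^sup>x\<close>.
  Enlarging every class to a maximal independent set only increases the number of colors
  available at each vertex; conversely, from maximal independent sets offering at least
  \<open>w u\<close> colors at every vertex \<open>u\<close> one discards the surplus colors vertex by vertex.
\<close>

lemma arcs_ends_induce_subgraph_iff:
  "(u, u') \<in> arcs_ends (G \<restriction> S) \<longleftrightarrow> (u, u') \<in> arcs_ends G \<and> u \<in> S \<and> u' \<in> S"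
  by (auto simp: arcs_ends_def arc_to_ends_def induce_subgraph_def)

text \<open>The subgraph is induced, so it keeps every adjacency of \<open>G\<close> between its
  vertices; independence can thus be compared directly with disjointness along arcs of
  \<open>G\<close>.\<close>

lemma independent_set_color_graph_iff:
  "independent_set (color_graph G L x) N \<longleftrightarrow>
     N \<subseteq> {u \<in> verts G. x \<in> L u} \<and> (\<forall>u\<in>N. \<forall>u'\<in>N. (u, u') \<notin> arcs_ends G)"
  unfolding independent_set_def color_graph_def
  by (auto simp: arcs_ends_induce_subgraph_iff)

text \<open>A finite vertex set has only finitely many independent subsets, so some
  inclusion-maximal one lies above \<open>N\<close>.\<close>

lemma independent_set_extends_to_maximal:
  assumes "finite (verts H)" and "independent_set H N"
  obtains M where "maximal_independent_set H M" and "N \<subseteq> M"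
proof -
  have "finite {M. independent_set H M}"
    by (rule finite_subset[of _ "Pow (verts H)"]) (auto simp: independent_set_def assms(1))
  then obtain M where M: "independent_set H M" "N \<subseteq> M"
    and max: "\<And>M'. independent_set H M' \<Longrightarrow> M \<subseteq> M' \<Longrightarrow> M = M'"
    using finite_has_maximal2[of "{M. independent_set H M}" N] assms(2) by auto
  have "maximal_independent_set H M"
    using M(1) max unfolding maximal_independent_set_def by (metis psubset_eq)
  then show ?thesis
    using M(2) by (rule that)
qed

lemma finite_all_colors:
  assumes "finite (verts G)" and "is_list G L"
  shows "finite (all_colors G L)"
  using assms by (simp add: all_colors_def is_list_def)

text \<open>The combinatorial core, free of vectors and of the enumeration \<open>v\<close>; what
  follows only translates it.\<close>

lemma colorable_iff_maximal_independent_sets: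
  assumes fin: "finite (verts G)" and L: "is_list G L"
  shows "colorable G L w \<longleftrightarrow>
    (\<exists>N. (\<forall>x\<in>all_colors G L. maximal_independent_set (color_graph G L x) (N x)) \<and>
         (\<forall>u\<in>verts G. w u \<le> card {x \<in> all_colors G L. u \<in> N x}))"
    (is "_ \<longleftrightarrow> (\<exists>N. ?max N \<and> ?le N)")
proof
  assume "colorable G L w"
  then obtain C where "is_coloring G L w C"
    unfolding colorable_def ..
  then have C: "\<And>u. u \<in> verts G \<Longrightarrow> C u \<subseteq> L u" "\<And>u. u \<in> verts G \<Longrightarrow> card (C u) = w u"
    and disj: "\<And>u u'. (u, u') \<in> arcs_ends G \<Longrightarrow> C u \<inter> C u' = {}"
    by (auto simp: is_coloring_def)
  \<comment> \<open>Adjacent vertices share no color, so color classes are independent. They are cut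
    down to \<open>verts G\<close> because \<open>C\<close> is unconstrained elsewhere.\<close>
  have "independent_set (color_graph G L x) {u \<in> verts G. x \<in> C u}" for x
    using C(1) disj unfolding independent_set_color_graph_iff by blast
  moreover have "finite (verts (color_graph G L x))" for x
    using fin by (simp add: color_graph_def)
  ultimately have "\<exists>M. maximal_independent_set (color_graph G L x) M \<and>
      {u \<in> verts G. x \<in> C u} \<subseteq> M" for x
    by (meson independent_set_extends_to_maximal)
  then obtain N where N: "\<And>x. maximal_independent_set (color_graph G L x) (N x)"
    "\<And>x. {u \<in> verts G. x \<in> C u} \<subseteq> N x"
    by metis
  have "w u \<le> card {x \<in> all_colors G L. u \<in> N x}" if "u \<in> verts G" for u
  proof -
    have "C u \<subseteq> {x \<in> all_colors G L. u \<in> N x}"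
      using that C(1) N(2) unfolding all_colors_def by blast
    then have "card (C u) \<le> card {x \<in> all_colors G L. u \<in> N x}"
      using finite_all_colors[OF fin L] by (intro card_mono) auto
    then show ?thesis
      using C(2) that by simp
  qed
  with N(1) show "\<exists>N. ?max N \<and> ?le N"
    by blast
next
  assume "\<exists>N. ?max N \<and> ?le N"
  then obtain N where N: "?max N" "?le N"
    by blast
  have ind: "N x \<subseteq> {u \<in> verts G. x \<in> L u}" "\<forall>u\<in>N x. \<forall>u'\<in>N x. (u, u') \<notin> arcs_ends G"
    if "x \<in> all_colors G L" for x
    using N(1) that
    by (auto simp: maximal_independent_set_def independent_set_color_graph_iff)
  have "\<forall>u\<in>verts G. \<exists>A. A \<subseteq> {x \<in> all_colors G L. u \<in> N x} \<and> card A = w u"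
    using N(2) by (meson obtain_subset_with_card_n)
  then obtain C where C: "\<And>u. u \<in> verts G \<Longrightarrow> C u \<subseteq> {x \<in> all_colors G L. u \<in> N x}"
    "\<And>u. u \<in> verts G \<Longrightarrow> card (C u) = w u"
    by metis
  \<comment> \<open>\<open>C\<close> is unspecified off \<open>verts G\<close>, while disjointness
    is demanded for every arc; the empty default settles arcs with an end outside
    \<open>verts G\<close>.\<close>
  define C' where "C' u = (if u \<in> verts G then C u else {})" for u
  have "C' u \<subseteq> L u" "card (C' u) = w u" if "u \<in> verts G" for u
    using that C(2) C(1)[OF that] ind(1) by (simp_all add: C'_def) blast
  moreover have "C' u \<inter> C' u' = {}" if "(u, u') \<in> arcs_ends G" for u u'
  proof (rule ccontr)
    assume "C' u \<inter> C' u' \<noteq> {}"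
    then obtain x where "x \<in> all_colors G L" "u \<in> N x" "u' \<in> N x"
      using C(1)[of u] C(1)[of u'] by (auto simp: C'_def split: if_splits)
    with ind(2) that show False
      by blast
  qed
  ultimately have "is_coloring G L w C'"
    by (simp add: is_coloring_def case_prod_beta)
  then show "colorable G L w"
    unfolding colorable_def by blast
qed

text \<open>Each color contributes 0 or 1 to coordinate \<open>i\<close>; this links vectorial sums
  to the counts in the coloring criterion.\<close>

lemma sum_vset_vec_apply:
  assumes "finite A" and "i \<in> {1..n}"
  shows "(\<Sum>x\<in>A. vset_vec n v (N x)) i = card {x \<in> A. v i \<in> N x}"
proof -
  have "(\<Sum>x\<in>A. vset_vec n v (N x)) i = (\<Sum>x\<in>A. vset_vec n v (N x) i)"
    using assms(1) by (induction A rule: finite_induct) auto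
  also have "\<dots> = (\<Sum>x\<in>A. if v i \<in> N x then 1 else 0)"
    using assms(2) by (simp add: vset_vec_def vec_of_apply)
  also have "\<dots> = card {x \<in> A. v i \<in> N x}"
    using assms(1) by (simp add: sum.If_cases Int_def)
  finally show ?thesis .
qed

text \<open>Membership in \<open>MIS\<close> yields only a vector for each color; choosing an
  underlying set for each one gives the family \<open>N\<close> of the coloring criterion.\<close>

lemma W_max_eq_sums:
  assumes "graph G" and "is_list G L"
  shows "W_max n v G L = {\<Sum>x\<in>all_colors G L. vset_vec n v (N x) | N.
    \<forall>x\<in>all_colors G L. maximal_independent_set (color_graph G L x) (N x)}" (is "_ = ?S")
proof
  show "?S \<subseteq> W_max n v G L"
    unfolding W_max_alt[OF assms] MIS_def by blast
  show "W_max n v G L \<subseteq> ?S"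
  proof
    fix y assume "y \<in> W_max n v G L"
    then obtain z where y: "y = (\<Sum>x\<in>all_colors G L. z x)"
      and "\<forall>x\<in>all_colors G L. \<exists>N. z x = vset_vec n v N \<and>
        maximal_independent_set (color_graph G L x) N"
      unfolding W_max_alt[OF assms] MIS_def by blast
    then obtain N where N: "\<forall>x\<in>all_colors G L. z x = vset_vec n v (N x) \<and>
        maximal_independent_set (color_graph G L x) (N x)"
      by metis
    then have "y = (\<Sum>x\<in>all_colors G L. vset_vec n v (N x))"
      unfolding y by (intro sum.cong) auto
    with N show "y \<in> ?S"
      by blast
  qed
qed

text \<open>Coordinates outside \<open>{1..n}\<close> of a weight vector are 0 and impose no
  condition on \<open>y\<close>.\<close>

lemma weight_vec_le_iff:
  "weight_vec n v w \<le> y \<longleftrightarrow> (\<forall>i\<in>{1..n}. w (v i) \<le> y i)"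
  by (auto simp: le_fun_def weight_vec_def vec_of_apply)

text \<open>Reading a vector back through the inverse enumeration gives a weight, so the vectors in
  \<open>lower_closure\<close> and the weights in \<open>W\<close> range over the same
  objects.\<close>

lemma nat_vecs_eq_range_weight_vec:
  assumes "inj_on v {1..n}"
  shows "nat_vecs n = range (weight_vec n v)"
proof
  show "nat_vecs n \<subseteq> range (weight_vec n v)"
  proof
    fix y assume "y \<in> nat_vecs n"
    then have "y = weight_vec n v (y \<circ> the_inv_into {1..n} v)"
      using assms
      by (auto simp: fun_eq_iff weight_vec_def vec_of_apply nat_vecs_def the_inv_into_f_f)
    then show "y \<in> range (weight_vec n v)"
      by blast
  qed
  show "range (weight_vec n v) \<subseteq> nat_vecs n"
    by (auto simp: weight_vec_def vec_of_apply nat_vecs_def)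
qed

theorem theorem4p1:
  fixes G :: "('a, 'b) pre_digraph"
    and L :: "'a \<Rightarrow> nat set"
    and n :: nat
    and v :: "nat \<Rightarrow> 'a"
  assumes "graph G"
    and "bij_betw v {1..n} (verts G)"
    and "is_list G L"
  shows "W n v G L = lower_closure n (W_max n v G L)
    \<and> (\<forall>w. colorable G L w \<longleftrightarrow> (\<exists>w'\<in>W_max n v G L. weight_vec n v w \<le> w'))"
proof -
  interpret graph G by fact
  have fin: "finite (all_colors G L)"
    using finite_all_colors[OF finite_verts assms(3)] .
  have verts: "verts G = v ` {1..n}" and inj: "inj_on v {1..n}"
    using assms(2) by (auto simp: bij_betw_def)
  \<comment> \<open>As \<open>v\<close> maps onto \<open>verts G\<close>, a condition on all
    coordinates is one on all vertices.\<close>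
  have le_iff: "weight_vec n v w \<le> (\<Sum>x\<in>all_colors G L. vset_vec n v (N x)) \<longleftrightarrow>
      (\<forall>u\<in>verts G. w u \<le> card {x \<in> all_colors G L. u \<in> N x})" for w N
    unfolding weight_vec_le_iff verts by (simp add: sum_vset_vec_apply[OF fin])
  have col: "colorable G L w \<longleftrightarrow> (\<exists>w'\<in>W_max n v G L. weight_vec n v w \<le> w')" for w
    unfolding colorable_iff_maximal_independent_sets[OF finite_verts assms(3)]
      W_max_eq_sums[OF assms(1,3)] le_iff[symmetric]
    by blast
  have "W n v G L = lower_closure n (W_max n v G L)"
    unfolding W_def lower_closure_def nat_vecs_eq_range_weight_vec[OF inj] col by blast
  with col show ?thesis
    by blast
qed

end
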